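(* Let $\bm C\in\mathbb S^d_{++}$, $\bm a_1,\dots,\bm a_n\in\mathbb R^d$, $s\in[n]$, and $\bm b_i:=\bm C^{-1/2}\bm a_i$ for $i\in[n]$. The D-optimal Data Fusion problem $$z^*:=\max_{S\subseteq[n],\,|S|=s}\log\det\Big(\bm C+\sum_{i\in S}\bm a_i\bm a_i^\top\Big)$$ is equivalent to $$\log\det\bm C+\max_{\bm x\in\mathcal Z_s}\ \log\det\Big(\bm I_d+\sum_{i\in[n]}x_i\bm b_i\bm b_i^\top\Big),$$ i.e. under the bijection between sets $S\subseteq[n]$ with $|S|=s$ and their characteristic vectors $\bm x\in\mathcal Z_s$ the objective values coincide, and in particular the second expression equals $z^*$.
   Context: $[n]=\{1,\dots,n\}$; $\mathbb S^d_{++}$ is the set of symmetric positive-definite $d\times d$ matrices; $\bm C^{1/2}$ is the positive-definite square root of $\bm C$; $\bm I_d$ is the identity matrix; $\mathcal Z_s:=\{\bm x\in\{0,1\}^n:\sum_{i\in[n]}x_i=s\}$. *)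

theory Defs
  imports "HOL-Analysis.Analysis"
begin

definition spd_matrices :: "(real ^ 'd ^ 'd) set"
  where "spd_matrices = {M. transpose M = M \<and> (\<forall>v. v \<noteq> 0 \<longrightarrow> v \<bullet> (M *v v) > 0)}"

(* A symmetric positive-definite matrix has exactly one symmetric positive-definite
   square root, so the description denotes it whenever M is in spd_matrices. *)
definition matrix_sqrt :: "real ^ 'd ^ 'd \<Rightarrow> real ^ 'd ^ 'd"
  where "matrix_sqrt M = (THE R. R \<in> spd_matrices \<and> R ** R = M)"

(* The inner dimension of the product is not determined by the type of v
   and has to be fixed to 1. *)
definition outer :: "real ^ 'd \<Rightarrow> real ^ 'd ^ 'd"
  where "outer v = (columnvector v :: real ^ 1 ^ 'd) ** (rowvector v :: real ^ 'd ^ 1)"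

definition size_subsets :: "nat \<Rightarrow> nat \<Rightarrow> nat set set"
  where "size_subsets n s = {S. S \<subseteq> {1..n} \<and> card S = s}"

(* Vectors in R^n are functions on {1..n}, extended by undefined outside,
   so that each vector is represented by exactly one function. *)
definition binary_vectors :: "nat \<Rightarrow> nat \<Rightarrow> (nat \<Rightarrow> real) set"
  where "binary_vectors n s = {x \<in> {1..n} \<rightarrow>\<^sub>E {0, 1}. (\<Sum>i\<in>{1..n}. x i) = real s}"

definition char_vector :: "nat \<Rightarrow> nat set \<Rightarrow> nat \<Rightarrow> real"
  where "char_vector n S = restrict (indicator S) {1..n}"

definition ddf_objective :: "real ^ 'd ^ 'd \<Rightarrow> (nat \<Rightarrow> real ^ 'd) \<Rightarrow> nat set \<Rightarrow> real"
  where "ddf_objective C a S = ln (det (C + (\<Sum>i\<in>S. outer (a i))))"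

definition ddf_value :: "real ^ 'd ^ 'd \<Rightarrow> nat \<Rightarrow> (nat \<Rightarrow> real ^ 'd) \<Rightarrow> nat \<Rightarrow> real"
  where "ddf_value C n a s = (MAX S\<in>size_subsets n s. ddf_objective C a S)"

definition binary_objective :: "nat \<Rightarrow> (nat \<Rightarrow> real ^ 'd) \<Rightarrow> (nat \<Rightarrow> real) \<Rightarrow> real"
  where "binary_objective n b x = ln (det (mat 1 + (\<Sum>i\<in>{1..n}. x i *\<^sub>R outer (b i))))"

end

theory Submission
  imports Defs
begin

(* With R the square root of C and a i = R *v b i, the matrix C plus the sum of the outer (a i)
   factors as R ** (mat 1 + sum of the outer (b i)) ** R, so the determinants multiply. The real
   work is that the square root, given by a description, exists (diagonalize in an orthonormal
   eigenbasis, obtained by maximizing the quadratic form on the unit sphere of an invariant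
   subspace) and is unique. Its existence also makes determinants positive, as needed for ln. *)

section \<open>Spectral theory of self-adjoint maps on a Euclidean space\<close>

lemma self_adjoint_eigenvector:
  fixes f :: "'a::euclidean_space \<Rightarrow> 'a"
  assumes lin: "linear f" and adj: "\<And>x y. x \<bullet> f y = f x \<bullet> y"
    and V: "subspace V" and inv: "f ` V \<subseteq> V" and nz: "V \<noteq> {0}"
  obtains v \<mu> where "v \<in> V" "norm v = 1" "f v = \<mu> *\<^sub>R v"
proof -
  let ?K = "sphere 0 1 \<inter> V"
  obtain x where x: "x \<in> V" "x \<noteq> 0"
    using nz subspace_0[OF V] by blast
  then have "x /\<^sub>R norm x \<in> ?K"
    by (simp add: subspace_scale[OF V])
  moreover have "compact ?K"
    by (intro compact_Int_closed compact_sphere closed_subspace V)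
  moreover have "continuous_on ?K (\<lambda>y. y \<bullet> f y)"
    by (intro continuous_intros linear_continuous_on linear_conv_bounded_linear[THEN iffD1] lin)
  ultimately obtain v where v: "v \<in> ?K" and max: "\<And>y. y \<in> ?K \<Longrightarrow> y \<bullet> f y \<le> v \<bullet> f v"
    using continuous_attains_sup[of ?K "\<lambda>y. y \<bullet> f y"] by blast
  define \<mu> where "\<mu> = v \<bullet> f v"
  have vv: "v \<in> V" "norm v = 1" "v \<bullet> v = 1"
    using v by (auto simp: dot_square_norm)
  \<comment> \<open>Both sides are quadratic in \<open>y\<close>, so the maximum on the unit sphere
    gives a bound on all of \<open>V\<close> by rescaling.\<close>
  have bound: "y \<bullet> f y \<le> \<mu> * (y \<bullet> y)" if "y \<in> V" for y
  proof (cases "y = 0")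
    case False
    have "y /\<^sub>R norm y \<in> ?K"
      using False that by (simp add: subspace_scale[OF V])
    from max[OF this] have "(y \<bullet> f y) / (norm y)\<^sup>2 \<le> \<mu>"
      by (simp add: linear_scale[OF lin] \<mu>_def power2_eq_square divide_inverse mult_ac)
    then show ?thesis
      using False by (simp add: dot_square_norm divide_le_eq)
  qed (simp add: linear_0[OF lin])
  (* The defect w vanishes: v maximizes the Rayleigh quotient on V, so moving from v
     in direction w cannot raise it to first order. *)
  define w where "w = f v - \<mu> *\<^sub>R v"
  have wV: "w \<in> V"
    unfolding w_def using inv vv by (intro subspace_diff subspace_scale V) auto
  have wv: "w \<bullet> v = 0"
    by (simp add: w_def inner_diff_left vv \<mu>_def inner_commute[of "f v" v])
  have wfv: "w \<bullet> f v = w \<bullet> w"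
    using wv by (simp add: w_def inner_diff_left inner_diff_right algebra_simps inner_commute)
  define q where "q = w \<bullet> f w - \<mu> * (w \<bullet> w)"
  \<comment> \<open>This is \<open>bound\<close> at \<open>v + t *\<^sub>R w\<close>: the constant
    terms cancel by the choice of \<mu>, and self-adjointness makes the two cross terms
    equal.\<close>
  have quad: "2 * t * (w \<bullet> w) + t\<^sup>2 * q \<le> 0" for t
  proof -
    have "v + t *\<^sub>R w \<in> V"
      by (intro subspace_add subspace_scale V vv wV)
    from bound[OF this] show ?thesis
      using wv wfv adj[of v w]
      by (simp add: linear_add[OF lin] linear_scale[OF lin] inner_add_left inner_add_right
          vv q_def \<mu>_def power2_eq_square algebra_simps inner_commute)
  qed
  have "w \<bullet> w = 0"
  proof (rule ccontr)
    assume "w \<bullet> w \<noteq> 0"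
    then have pos: "w \<bullet> w > 0"
      by simp
    \<comment> \<open>With this \<open>t\<close>, the product of \<open>t\<close> and the absolute
      value of \<open>q\<close> stays below \<open>w \<bullet> w\<close>, so the first-order term
      dominates; adding 1 avoids division by zero.\<close>
    define t where "t = (w \<bullet> w) / (\<bar>q\<bar> + 1)"
    have t: "t > 0" "t * (\<bar>q\<bar> + 1) = w \<bullet> w"
      using pos by (auto simp: t_def add_nonneg_eq_0_iff)
    have "t * (2 * (w \<bullet> w) + t * q) \<le> 0"
      using quad[of t] by (simp add: power2_eq_square algebra_simps)
    then have "2 * (w \<bullet> w) + t * q \<le> 0"
      using t(1) by (simp add: mult_le_0_iff)
    moreover have "t * \<bar>q\<bar> \<ge> - (t * q)"
      using t(1) by (metis abs_ge_minus_self abs_mult abs_of_pos)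
    ultimately show False
      using t pos by (simp add: algebra_simps)
  qed
  then show thesis
    using that[of v \<mu>] vv by (simp add: w_def)
qed

text \<open>Induction on the dimension: split off one unit eigenvector and continue in its
  orthogonal complement within \<open>V\<close>. Admitting every invariant subspace lets the
  induction hypothesis apply to that complement.\<close>

lemma self_adjoint_orthonormal_eigenbasis:
  fixes f :: "'a::euclidean_space \<Rightarrow> 'a"
  assumes lin: "linear f" and adj: "\<And>x y. x \<bullet> f y = f x \<bullet> y"
    and "subspace V" "f ` V \<subseteq> V"
  shows "\<exists>B \<nu>. finite B \<and> pairwise orthogonal B \<and> (\<forall>b\<in>B. norm b = 1 \<and> f b = \<nu> b *\<^sub>R b)
    \<and> span B = V"
  using assms(3,4)
proof (induction "dim V" arbitrary: V rule: less_induct)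
  case less
  note V = less.prems
  show ?case
  proof (cases "V = {0}")
    case True
    then show ?thesis
      by (intro exI[of _ "{}"]) auto
  next
    case False
    then obtain v \<mu> where v: "v \<in> V" "norm v = 1" "f v = \<mu> *\<^sub>R v"
      using self_adjoint_eigenvector[OF lin adj V] by blast
    then have vv: "v \<bullet> v = 1"
      by (simp add: dot_square_norm)
    define W where "W = {w \<in> V. v \<bullet> w = 0}"
    have W: "subspace W"
      using V by (auto simp: W_def subspace_def inner_add_right)
    have "v \<notin> W" "W \<subseteq> V"
      using vv by (auto simp: W_def)
    then have "W \<subset> V"
      using v by blast
    then have "dim W < dim V"
      using W V by (intro dim_psubset) (simp add: span_eq_iff[THEN iffD2])
    \<comment> \<open>Self-adjointness moves \<open>f\<close> onto the eigenvector \<open>v\<close>,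
      so orthogonality to \<open>v\<close> is preserved.\<close>
    moreover have "f ` W \<subseteq> W"
      using V by (auto simp: W_def adj v)
    ultimately obtain B \<nu> where B: "finite B" "pairwise orthogonal B"
      "\<forall>b\<in>B. norm b = 1 \<and> f b = \<nu> b *\<^sub>R b" "span B = W"
      using less.hyps W by metis
    have BW: "b \<in> W" if "b \<in> B" for b
      using that B(4) span_base by blast
    then have vB: "v \<notin> B"
      using vv by (auto simp: W_def)
    have "span (insert v B) = V"
    proof
      show "span (insert v B) \<subseteq> V"
        using v BW V by (intro span_minimal) (auto simp: W_def)
      show "V \<subseteq> span (insert v B)"
      proof
        fix x assume "x \<in> V"
        then have "x - (v \<bullet> x) *\<^sub>R v \<in> W"
          using v vv V by (simp add: W_def subspace_diff subspace_scale inner_diff_right)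
        then show "x \<in> span (insert v B)"
          using B(4) by (auto simp: span_insert)
      qed
    qed
    moreover have "pairwise orthogonal (insert v B)"
      using B(2) BW by (auto simp: pairwise_insert orthogonal_def W_def inner_commute)
    ultimately show ?thesis
      using B v vB by (intro exI[of _ "insert v B"] exI[of _ "\<lambda>b. if b = v then \<mu> else \<nu> b"]) auto
  qed
qed

section \<open>Matrix algebra and rank-one matrices\<close>

lemma matrix_mult_add_rdistrib: "(A + B) ** C = A ** C + B ** C"
  by (vector matrix_matrix_mult_def sum.distrib[symmetric] field_simps)

lemma matrix_mult_matrix_inv:
  assumes "invertible A"
  shows "A ** matrix_inv A = mat 1"
  using someI_ex[OF assms[unfolded invertible_def]] by (simp add: matrix_inv_def)

lemma outer_mult_vec: "outer v *v x = (v \<bullet> x) *\<^sub>R v"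
  by (simp add: outer_def vec_eq_iff matrix_vector_mult_def matrix_matrix_mult_def
      columnvector_def rowvector_def inner_vec_def sum_distrib_left sum_distrib_right mult_ac)

lemma transpose_outer: "transpose (outer v) = outer v"
  by (simp add: outer_def vec_eq_iff transpose_def matrix_matrix_mult_def
      columnvector_def rowvector_def mult_ac)

lemma transpose_add: "transpose (A + B) = transpose A + transpose B"
  by (simp add: vec_eq_iff transpose_def)

lemma transpose_sum: "transpose (\<Sum>i\<in>I. F i) = (\<Sum>i\<in>I. transpose (F i))"
  by (simp add: vec_eq_iff transpose_def)

lemma sum_mult_vec: "(\<Sum>i\<in>I. F i) *v x = (\<Sum>i\<in>I. F i *v x)"
  for F :: "'i \<Rightarrow> real ^ 'n ^ 'm"
  by (induction I rule: infinite_finite_induct) (auto simp: matrix_vector_mult_add_rdistrib)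

lemma outer_matrix_mult: "outer (M *v v) = M ** outer v ** transpose M"
  by (simp add: outer_def dot_rowvector_columnvector transpose_columnvector[symmetric]
      matrix_transpose_mul matrix_mul_assoc)

section \<open>Positive-definite matrices and their square roots\<close>

lemma spd_matrices_inner_commute:
  assumes "M \<in> spd_matrices"
  shows "x \<bullet> (M *v y) = (M *v x) \<bullet> y"
  using assms dot_lmul_matrix[of x M y] vector_transpose_matrix[of x M]
  by (simp add: spd_matrices_def)

lemma spd_matrices_ker:
  assumes "M \<in> spd_matrices" "M *v x = 0"
  shows "x = 0"
  using assms by (force simp: spd_matrices_def)

lemma spd_matrices_invertible:
  assumes "M \<in> spd_matrices"
  shows "invertible M"
  using spd_matrices_ker[OF assms] matrix_left_invertible_ker invertible_left_inverse by metis

text \<open>In an orthonormal eigenbasis of \<open>M\<close>, take the matrix that scales each basis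
  vector by the square root of its eigenvalue.\<close>

lemma spd_matrices_sqrt_exists:
  fixes M :: "real ^ 'd ^ 'd"
  assumes M: "M \<in> spd_matrices"
  shows "\<exists>R. R \<in> spd_matrices \<and> R ** R = M"
proof -
  obtain B :: "(real ^ 'd) set" and \<nu> where B: "finite B" "pairwise orthogonal B"
    and eig: "\<forall>b\<in>B. norm b = 1 \<and> M *v b = \<nu> b *\<^sub>R b" and span: "span B = UNIV"
    using self_adjoint_orthonormal_eigenbasis[of "(*v) M" UNIV]
      spd_matrices_inner_commute[OF M] by auto
  have on: "b \<bullet> c = (if b = c then 1 else 0)" if "b \<in> B" "c \<in> B" for b c
    using B(2) eig that by (auto simp: pairwise_def orthogonal_def dot_square_norm)
  have pos: "\<nu> b > 0" if "b \<in> B" for b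
  proof -
    have "b \<noteq> 0"
      using on that by force
    then have "b \<bullet> (M *v b) > 0"
      using M by (simp add: spd_matrices_def)
    then show ?thesis
      using on eig that by simp
  qed
  define R where "R = (\<Sum>b\<in>B. sqrt (\<nu> b) *\<^sub>R outer b)"
  have Rx: "R *v x = (\<Sum>b\<in>B. (sqrt (\<nu> b) * (b \<bullet> x)) *\<^sub>R b)" for x
    by (simp add: R_def sum_mult_vec scaleR_matrix_vector_assoc[symmetric] outer_mult_vec)
  have Rb: "R *v b = sqrt (\<nu> b) *\<^sub>R b" if "b \<in> B" for b
  proof -
    have "R *v b = (\<Sum>c\<in>B. if c = b then sqrt (\<nu> b) *\<^sub>R b else 0)"
      unfolding Rx using that by (intro sum.cong) (auto simp: on)
    then show ?thesis
      using that B(1) by simp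
  qed
  \<comment> \<open>Both sides are linear in \<open>x\<close> and agree on \<open>B\<close>, which
    spans the space.\<close>
  have "(R ** R) *v x = M *v x" for x
  proof (rule linear_eq_on_span[of "(*v) (R ** R)" "(*v) M" B])
    show "(R ** R) *v b = M *v b" if "b \<in> B" for b
      using that pos[OF that] eig
      by (simp add: matrix_vector_mul_assoc[symmetric] Rb matrix_vector_mult_scaleR)
  qed (auto simp: span)
  then have "R ** R = M"
    by (simp add: matrix_eq)
  moreover have "x \<bullet> (R *v x) > 0" if "x \<noteq> 0" for x
  proof -
    have eq: "x \<bullet> (R *v x) = (\<Sum>b\<in>B. sqrt (\<nu> b) * (b \<bullet> x)\<^sup>2)"
      by (simp add: Rx inner_sum_right power2_eq_square inner_commute mult_ac)
    \<comment> \<open>A vector orthogonal to all of \<open>B\<close> is orthogonal to the whole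
      space, hence to itself.\<close>
    obtain b where "b \<in> B" "b \<bullet> x \<noteq> 0"
    proof (rule ccontr)
      assume "\<not> thesis"
      then have "\<forall>b\<in>B. orthogonal x b"
        using that by (auto simp: orthogonal_def inner_commute)
      then have "orthogonal x x"
        using orthogonal_to_span[of x B] span by blast
      then show False
        using \<open>x \<noteq> 0\<close> by (simp add: orthogonal_def)
    qed
    then show ?thesis
      unfolding eq using pos B(1) less_imp_le[OF pos] by (intro sum_pos2[of B b]) auto
  qed
  moreover have "transpose R = R"
    by (simp add: R_def transpose_sum transpose_scalar transpose_outer)
  ultimately show ?thesis
    by (auto simp: spd_matrices_def)
qed

text \<open>By symmetry of \<open>D\<close>, each diagonal entry of the product is the quadratic
  form of \<open>R\<close> at a column of \<open>D\<close>. For positive-definite \<open>R\<close>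
  the trace is thus nonnegative and vanishes only for \<open>D = 0\<close>.\<close>

lemma trace_sandwich:
  fixes D R :: "real ^ 'd ^ 'd"
  assumes "transpose D = D"
  shows "trace (D ** R ** D) = (\<Sum>j\<in>UNIV. column j D \<bullet> (R *v column j D))"
proof -
  have D: "D $ i $ j = D $ j $ i" for i j
    using assms by (metis transpose_def vec_lambda_beta)
  show ?thesis
    unfolding matrix_mul_assoc[symmetric]
    by (simp add: trace_def inner_vec_def matrix_matrix_mult_def matrix_vector_mult_def column_def D)
qed

(* For D = R - S one has R D + D S = R R - S S = 0, so the traces of D R D and D S D
   cancel, although both are nonnegative. *)
lemma spd_matrices_sqrt_unique:
  fixes R S :: "real ^ 'd ^ 'd"
  assumes R: "R \<in> spd_matrices" and S: "S \<in> spd_matrices" and eq: "R ** R = S ** S"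
  shows "R = S"
proof -
  define D where "D = R - S"
  have sym: "transpose D = D"
    using R S by (simp add: D_def spd_matrices_def vec_eq_iff transpose_def)
  have nonneg: "x \<bullet> (M *v x) \<ge> 0" if "M \<in> spd_matrices" for M and x :: "real ^ 'd"
    using that by (cases "x = 0") (auto simp: spd_matrices_def less_imp_le)
  have "R = D + S"
    by (simp add: D_def)
  \<comment> \<open>Only the right factor is split; the \<open>R\<close> in \<open>R ** S\<close> is
    then rewritten as \<open>D + S\<close>.\<close>
  then have "R ** R = R ** D + (D + S) ** S"
    by (metis matrix_add_ldistrib)
  then have "R ** D + D ** S = 0"
    by (simp add: matrix_mult_add_rdistrib eq)
  then have "trace (D ** (R ** D + D ** S)) = 0"
    by (simp add: trace_def)
  \<comment> \<open>Cyclicity of the trace brings the second term into sandwich form.\<close>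
  then have "trace (D ** R ** D) + trace (D ** S ** D) = 0"
    using trace_mul_sym[of D "D ** S"]
    by (simp add: matrix_add_ldistrib trace_add matrix_mul_assoc)
  moreover have "trace (D ** S ** D) \<ge> 0"
    unfolding trace_sandwich[OF sym] by (intro sum_nonneg nonneg S)
  moreover have "trace (D ** R ** D) \<ge> 0"
    unfolding trace_sandwich[OF sym] by (intro sum_nonneg nonneg R)
  ultimately have "trace (D ** R ** D) = 0"
    by linarith
  then have "column j D \<bullet> (R *v column j D) = 0" for j
    unfolding trace_sandwich[OF sym] by (subst (asm) sum_nonneg_eq_0_iff) (auto simp: nonneg[OF R])
  then have "column j D = 0" for j
    using R by (force simp: spd_matrices_def)
  then have "D = 0"
    by (simp add: column_def vec_eq_iff)
  then show ?thesis
    by (simp add: D_def)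
qed

text \<open>Existence and uniqueness together justify unfolding the definite description.\<close>

lemma matrix_sqrt_spd_matrices:
  assumes "M \<in> spd_matrices"
  shows "matrix_sqrt M \<in> spd_matrices" "matrix_sqrt M ** matrix_sqrt M = M"
proof -
  have "\<exists>!R. R \<in> spd_matrices \<and> R ** R = M"
    using spd_matrices_sqrt_exists[OF assms] spd_matrices_sqrt_unique by metis
  from theI'[OF this] show "matrix_sqrt M \<in> spd_matrices" "matrix_sqrt M ** matrix_sqrt M = M"
    by (auto simp: matrix_sqrt_def)
qed

section \<open>Determinants and the change of variables\<close>

lemma spd_matrices_det_pos:
  assumes "M \<in> spd_matrices"
  shows "det M > 0"
proof -
  \<comment> \<open>As a real square the determinant is nonnegative, so invertibility makes it
    positive.\<close>
  have "det M = det (matrix_sqrt M) * det (matrix_sqrt M)"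
    using matrix_sqrt_spd_matrices[OF assms] by (metis det_mul)
  moreover have "det M \<noteq> 0"
    using spd_matrices_invertible[OF assms] by (simp add: invertible_det_nz)
  ultimately show ?thesis
    by (metis mult_eq_0_iff not_real_square_gt_zero)
qed

text \<open>The quadratic form is the squared norm plus a sum of squares. This makes the second
  logarithm well behaved.\<close>

lemma mat_1_add_outer_spd_matrices: "mat 1 + (\<Sum>i\<in>I. outer (b i)) \<in> spd_matrices"
proof -
  have "x \<bullet> ((mat 1 + (\<Sum>i\<in>I. outer (b i))) *v x) = x \<bullet> x + (\<Sum>i\<in>I. (b i \<bullet> x)\<^sup>2)" for x
    by (simp add: matrix_vector_mult_add_rdistrib sum_mult_vec outer_mult_vec inner_add_right
        inner_sum_right power2_eq_square inner_commute)
  moreover have "transpose (mat 1 + (\<Sum>i\<in>I. outer (b i))) = mat 1 + (\<Sum>i\<in>I. outer (b i))"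
    by (simp add: transpose_add transpose_sum transpose_outer)
  ultimately show ?thesis
    by (simp add: spd_matrices_def add_pos_nonneg sum_nonneg)
qed

text \<open>The two outer factors \<open>R\<close> contribute \<open>det (R ** R) = det C\<close>,
  and positivity of both determinants lets the logarithm split.\<close>

lemma ln_det_add_outer:
  assumes C: "C \<in> spd_matrices"
    and b: "\<And>i. i \<in> I \<Longrightarrow> b i = matrix_inv (matrix_sqrt C) *v a i"
  shows "ln (det (C + (\<Sum>i\<in>I. outer (a i)))) = ln (det C) + ln (det (mat 1 + (\<Sum>i\<in>I. outer (b i))))"
proof -
  define R where "R = matrix_sqrt C"
  have R: "R \<in> spd_matrices" "R ** R = C"
    using matrix_sqrt_spd_matrices[OF C] by (auto simp: R_def)
  have Rt: "transpose R = R"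
    using R(1) by (simp add: spd_matrices_def)
  have "outer (a i) = R ** outer (b i) ** R" if "i \<in> I" for i
  proof -
    have "a i = R *v b i"
      using spd_matrices_invertible[OF R(1)] b[OF that]
      by (simp add: R_def matrix_vector_mul_assoc matrix_mult_matrix_inv)
    then show ?thesis
      using Rt by (simp add: outer_matrix_mult)
  qed
  then have "(\<Sum>i\<in>I. outer (a i)) = (\<Sum>i\<in>I. R ** outer (b i) ** R)"
    by simp
  \<comment> \<open>For infinite \<open>I\<close> both sums default to 0.\<close>
  also have "\<dots> = R ** (\<Sum>i\<in>I. outer (b i)) ** R"
    by (induction I rule: infinite_finite_induct)
      (auto simp: matrix_add_ldistrib matrix_mult_add_rdistrib)
  finally have "C + (\<Sum>i\<in>I. outer (a i)) = R ** (mat 1 + (\<Sum>i\<in>I. outer (b i))) ** R"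
    using R(2) by (simp add: matrix_add_ldistrib matrix_mult_add_rdistrib)
  then have "det (C + (\<Sum>i\<in>I. outer (a i))) = det C * det (mat 1 + (\<Sum>i\<in>I. outer (b i)))"
    using R(2) by (auto simp: det_mul)
  then show ?thesis
    using spd_matrices_det_pos[OF C] spd_matrices_det_pos[OF mat_1_add_outer_spd_matrices[where b = b and I = I]]
    by (simp add: ln_mult)
qed

section \<open>Subsets and their characteristic vectors\<close>

lemma bij_betw_char_vector:
  "bij_betw (char_vector n) (size_subsets n s) (binary_vectors n s)"
\<comment> \<open>The inverse reads off the support. Off \<open>{1..n}\<close> both a binary vector
  and a characteristic vector are \<open>undefined\<close>, so the round trip is an equality of
  functions.\<close>
proof (rule bij_betw_byWitness[where f' = "\<lambda>x. {i \<in> {1..n}. x i = 1}"])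
  show "\<forall>S\<in>size_subsets n s. {i \<in> {1..n}. char_vector n S i = 1} = S"
    by (auto simp: size_subsets_def char_vector_def indicator_def)
  show "\<forall>x\<in>binary_vectors n s. char_vector n {i \<in> {1..n}. x i = 1} = x"
    by (force simp: binary_vectors_def char_vector_def indicator_def restrict_def PiE_iff
        extensional_def)
  show "char_vector n ` size_subsets n s \<subseteq> binary_vectors n s"
    by (auto simp: binary_vectors_def char_vector_def size_subsets_def sum_indicator_eq_card
        indicator_def Int_absorb1 split: if_splits)
  show "(\<lambda>x. {i \<in> {1..n}. x i = 1}) ` binary_vectors n s \<subseteq> size_subsets n s"
  proof clarsimp
    fix x assume x: "x \<in> binary_vectors n s"
    have "real s = (\<Sum>i\<in>{1..n}. x i)"
      using x by (simp add: binary_vectors_def)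
    \<comment> \<open>Entries are 0 or 1, so the sum counts the ones.\<close>
    also have "\<dots> = (\<Sum>i\<in>{1..n}. if x i = 1 then 1 else 0)"
      using x by (intro sum.cong) (auto simp: binary_vectors_def PiE_iff)
    also have "\<dots> = real (card {i \<in> {1..n}. x i = 1})"
      by (simp add: sum.inter_filter[symmetric])
    finally show "{i. Suc 0 \<le> i \<and> i \<le> n \<and> x i = 1} \<in> size_subsets n s"
      by (auto simp: size_subsets_def)
  qed
qed

lemma binary_objective_char_vector:
  assumes "S \<subseteq> {1..n}"
  shows "binary_objective n b (char_vector n S) = ln (det (mat 1 + (\<Sum>i\<in>S. outer (b i))))"
proof -
  have "(\<Sum>i\<in>{1..n}. char_vector n S i *\<^sub>R outer (b i)) = (\<Sum>i\<in>{1..n}. if i \<in> S then outer (b i) else 0)"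
    by (intro sum.cong) (auto simp: char_vector_def)
  also have "\<dots> = (\<Sum>i\<in>S. outer (b i))"
    using assms by (simp add: sum.inter_restrict[symmetric] Int_absorb1)
  finally show ?thesis
    by (simp add: binary_objective_def)
qed

theorem proposition4:
  fixes C :: "real ^ 'd ^ 'd"
    and a b :: "nat \<Rightarrow> real ^ 'd"
    and n s :: nat
  assumes "C \<in> spd_matrices"
    and "s \<in> {1..n}"
    and "\<And>i. i \<in> {1..n} \<Longrightarrow> b i = matrix_inv (matrix_sqrt C) *v a i"
  shows "bij_betw (char_vector n) (size_subsets n s) (binary_vectors n s)
    \<and> (\<forall>S\<in>size_subsets n s.
          ddf_objective C a S = ln (det C) + binary_objective n b (char_vector n S))
    \<and> ddf_value C n a s
        = ln (det C) + (MAX x\<in>binary_vectors n s. binary_objective n b x)"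
proof (intro conjI)
  show bij: "bij_betw (char_vector n) (size_subsets n s) (binary_vectors n s)"
    by (rule bij_betw_char_vector)
  show obj: "\<forall>S\<in>size_subsets n s.
      ddf_objective C a S = ln (det C) + binary_objective n b (char_vector n S)"
  proof
    fix S assume "S \<in> size_subsets n s"
    then have "S \<subseteq> {1..n}"
      by (simp add: size_subsets_def)
    then show "ddf_objective C a S = ln (det C) + binary_objective n b (char_vector n S)"
      using ln_det_add_outer[OF assms(1), of S b a] assms(3)
      by (simp add: ddf_objective_def binary_objective_char_vector subset_iff)
  qed
  have "finite (size_subsets n s)"
    by (rule finite_subset[of _ "Pow {1..n}"]) (auto simp: size_subsets_def)
  \<comment> \<open>This set witnesses nonemptiness, using \<open>s \<le> n\<close>; shifting a
    maximum by a constant requires a nonempty finite index set.\<close>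
  moreover have "{1..s} \<in> size_subsets n s"
    using assms(2) by (auto simp: size_subsets_def)
  ultimately have "Max ((\<lambda>S. binary_objective n b (char_vector n S) + ln (det C)) ` size_subsets n s)
      = (MAX S\<in>size_subsets n s. binary_objective n b (char_vector n S)) + ln (det C)"
    by (intro Max_add_commute) auto
  moreover have "ddf_objective C a ` size_subsets n s
      = (\<lambda>S. binary_objective n b (char_vector n S) + ln (det C)) ` size_subsets n s"
    using obj by (intro image_cong) auto
  \<comment> \<open>Surjectivity of the bijection turns the maximum over sets into one over binary
    vectors.\<close>
  moreover have "(\<lambda>S. binary_objective n b (char_vector n S)) ` size_subsets n s
      = binary_objective n b ` binary_vectors n s"
    by (simp add: bij_betw_imp_surj_on[OF bij, symmetric] image_image)
  ultimately show "ddf_value C n a s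
      = ln (det C) + (MAX x\<in>binary_vectors n s. binary_objective n b x)"
    by (simp add: ddf_value_def)
qed

end
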